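(* Let $k>3$ be a prime power. For every $v$ with $2k\leq v<4k$ and $v(v-1)\equiv 0\pmod{2k}$, \[\mathcal{L}_1S_k(v)=\{n\geq v-1\mid n\equiv 0,1\pmod 4\}.\]
   Context: All graphs are finite and simple; $\Gamma\leq K$ means $\Gamma$ is a subgraph of $K$ (or is isomorphic to one, when $\Gamma$ is an abstract graph). $P_3$ is the path on $3$ vertices; $S_k$ is the star on $k+1$ vertices, i.e. the complete bipartite graph $K_{1,k}$. For a graph $K$ and $\Gamma\leq K$, a $(K,\Gamma)$-design is a set $\mathcal{B}$ of subgraphs of $K$, called blocks, each isomorphic to $\Gamma$, whose edge-sets partition $E(K)$. $K_n$ is the complete graph on a set of $n$ vertices (any $n$-element vertex set may be used); a $\Gamma$-design of order $n$ is a $(K_n,\Gamma)$-design. Given $\Gamma'\leq\Gamma$, a $(K,\Gamma)$-design $\mathcal{B}$ and a $(K',\Gamma')$-design $\mathcal{B}'$, a down-link from $\mathcal{B}$ to $\mathcal{B}'$ is a function $f:\mathcal{B}\to\mathcal{B}'$ such that $f(B)$ is a subgraph of $B$ for every $B\in\mathcal{B}$ (the vertex sets of $K$ and $K'$ need not coincide, and either may be the larger). Take $\Gamma'=P_3$. For $v$ such that a $(K_v,\Gamma)$-design exists, $\mathcal{L}_1\Gamma(v)$ is the set of all integers $n$ such that some $\Gamma$-design of order $v$ can be down-linked to a $P_3$-design of order $n$. A $(K_v,S_k)$-design exists if and only if $v\geq 2k$ and $v(v-1)\equiv 0\pmod{2k}$. *)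

theory Defs
  imports Main "HOL-Library.FuncSet" "HOL-Library.Disjoint_Sets"
    "HOL-Number_Theory.Cong" "HOL-Number_Theory.Prime_Powers"
begin

datatype 'a graph = Graph (verts: "'a set") (edges: "'a set set")

definition simple_graph :: "'a graph \<Rightarrow> bool" where
  "simple_graph G \<longleftrightarrow> finite (verts G) \<and> (\<forall>e\<in>edges G. e \<subseteq> verts G \<and> card e = 2)"

definition subgraph :: "'a graph \<Rightarrow> 'a graph \<Rightarrow> bool" where
  "subgraph H G \<longleftrightarrow> simple_graph H \<and> simple_graph G \<and> verts H \<subseteq> verts G \<and> edges H \<subseteq> edges G"

definition graph_iso :: "'a graph \<Rightarrow> 'b graph \<Rightarrow> bool" where
  "graph_iso G H \<longleftrightarrow> (\<exists>\<phi>. bij_betw \<phi> (verts G) (verts H) \<and> edges H = (\<lambda>e. \<phi> ` e) ` edges G)"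

definition complete_graph :: "'a set \<Rightarrow> 'a graph" where
  "complete_graph V = Graph V {e. e \<subseteq> V \<and> card e = 2}"

definition path_graph :: "nat \<Rightarrow> nat graph" where
  "path_graph m = Graph {..<m} {{i, Suc i} |i. Suc i < m}"

definition star_graph :: "nat \<Rightarrow> nat graph" where
  "star_graph k = Graph {..k} {{0, i} |i. 1 \<le> i \<and> i \<le> k}"

definition is_design :: "'a graph \<Rightarrow> 'b graph \<Rightarrow> 'a graph set \<Rightarrow> bool" where
  "is_design K \<Gamma> \<B> \<longleftrightarrow>
     (\<forall>B\<in>\<B>. subgraph B K \<and> graph_iso B \<Gamma>) \<and>
     disjoint_family_on edges \<B> \<and> (\<Union>B\<in>\<B>. edges B) = edges K"

definition down_link :: "('a graph \<Rightarrow> 'a graph) \<Rightarrow> 'a graph set \<Rightarrow> 'a graph set \<Rightarrow> bool" where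
  "down_link f \<B> \<B>' \<longleftrightarrow> f \<in> \<B> \<rightarrow> \<B>' \<and> (\<forall>B\<in>\<B>. subgraph (f B) B)"

text \<open>Both complete graphs live on arbitrary finite subsets of the common infinite universe
  \<^typ>\<open>nat\<close>, so their vertex sets may overlap in any way.\<close>

definition L1 :: "'b graph \<Rightarrow> nat \<Rightarrow> nat set" where
  "L1 \<Gamma> v = {n. \<exists>(V :: nat set) (W :: nat set) \<B> \<B>' f.
     finite V \<and> card V = v \<and> finite W \<and> card W = n \<and>
     is_design (complete_graph V) \<Gamma> \<B> \<and>
     is_design (complete_graph W) (path_graph 3) \<B>' \<and>
     down_link f \<B> \<B>'}"

end

theory Submission
  imports Defs
begin

text \<open>Each star contains a path through its centre, so all centres lie in the second vertex set;
  since two non-centres would leave the edge between them uncovered, \<open>n \<ge> v - 1\<close>. The congruence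
  says that \<open>K\<^sub>n\<close> has an even number of edges.

  Conversely, an \<open>S\<^sub>k\<close>-design amounts to an orientation of \<open>K\<^sub>v\<close> whose out-degrees are multiples of
  \<open>k\<close>, the out-neighbourhoods being cut into leaf sets of size \<open>k\<close>. Take such an orientation with a
  sink \<open>z\<close>. As \<open>k \<ge> 4\<close>, every star contains a path avoiding \<open>z\<close> and one further leaf reserved for its
  centre. The reserved edges keep the complement of these paths in \<open>K\<^sub>n\<close> connected, and a connected
  graph with an even number of edges decomposes into copies of \<open>P\<^sub>3\<close>. Because \<open>k\<close> is a prime power,
  only \<open>v = 2k, 2k + 1\<close> and, for odd \<open>k\<close>, \<open>v = 3k, 3k + 1\<close> occur, where the orientation is explicit.\<close>

section \<open>Stars and paths as explicit graphs\<close>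

text \<open>With two leaves this is a path centred at \<open>c\<close>, so blocks of both designs
  can be built in this one form.\<close>

definition star :: "'a \<Rightarrow> 'a set \<Rightarrow> 'a graph" where
  "star c L = Graph (insert c L) ((\<lambda>x. {c, x}) ` L)"

lemma simple_graph_star:
  assumes "finite L" "c \<notin> L"
  shows "simple_graph (star c L)"
  using assms by (auto simp: simple_graph_def star_def card_2_iff)

lemma star_mono:
  assumes "finite L" "c \<notin> L" "M \<subseteq> L"
  shows "subgraph (star c M) (star c L)"
proof -
  have "simple_graph (star c L)" "simple_graph (star c M)"
    using assms finite_subset[of M L] by (blast intro: simple_graph_star)+
  then show ?thesis
    using assms(3) by (auto simp: subgraph_def star_def)
qed

lemma graph_iso_star_graph:
  assumes "finite L" "c \<notin> L"
  shows "graph_iso (star c L) (star_graph (card L))"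
proof -
  obtain g where g: "bij_betw g L {1..card L}"
    using assms(1) by (metis finite_same_card_bij finite_atLeastAtMost card_atLeastAtMost diff_Suc_1)
  \<comment> \<open>In \<open>star_graph\<close> the centre is \<open>0\<close> and the leaves are
    \<open>1..k\<close>, so the bijection of the leaves is extended by sending \<open>c\<close> to
    \<open>0\<close>.\<close>
  define \<phi> where "\<phi> = g(c := 0)"
  have \<phi>L: "\<phi> x = g x" if "x \<in> L" for x
    using that assms(2) by (auto simp: \<phi>_def)
  have "bij_betw \<phi> L {1..card L}"
    using g \<phi>L by (simp cong: bij_betw_cong)
  then have "bij_betw \<phi> (insert c L) (insert (\<phi> c) {1..card L})"
    using assms(2) by (auto simp: bij_betw_def \<phi>_def)
  moreover have "insert (\<phi> c) {1..card L} = {..card L}"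
    by (auto simp: \<phi>_def)
  moreover have "{{0, i} |i. 1 \<le> i \<and> i \<le> card L} = (\<lambda>e. \<phi> ` e) ` (\<lambda>x. {c, x}) ` L"
  proof -
    have "{{0, i} |i. 1 \<le> i \<and> i \<le> card L} = (\<lambda>i. {0, i}) ` {1..card L}" by auto
    also have "{1..card L} = \<phi> ` L" using \<open>bij_betw \<phi> L _\<close> by (simp add: bij_betw_def)
    also have "(\<lambda>i. {0, i}) ` \<phi> ` L = (\<lambda>e. \<phi> ` e) ` (\<lambda>x. {c, x}) ` L"
      by (simp add: image_image) (simp add: \<phi>_def)
    finally show ?thesis .
  qed
  ultimately show ?thesis
    unfolding graph_iso_def star_def star_graph_def graph.sel by metis
qed

lemma edges_path_graph_3: "edges (path_graph 3) = {{0, 1}, {1, 2}}"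
proof -
  have "Suc i < 3 \<longleftrightarrow> i = 0 \<or> i = 1" for i by auto
  then show ?thesis by (auto simp: path_graph_def numeral_2_eq_2)
qed

lemma graph_iso_star_path:
  assumes "card L = 2" "c \<notin> L"
  shows "graph_iso (star c L) (path_graph 3)"
proof -
  obtain x y where L: "L = {x, y}" "x \<noteq> y"
    using assms(1) by (auto simp: card_2_iff)
  define \<phi> where "\<phi> = (\<lambda>u. if u = c then 1 else if u = x then 0 else (2::nat))"
  have "bij_betw \<phi> (insert c L) {0, 1, 2}"
    using L assms(2) by (auto simp: bij_betw_def inj_on_def \<phi>_def)
  moreover have "verts (path_graph 3) = {0, 1, 2}"
    by (auto simp: path_graph_def)
  moreover have "{{0, 1}, {1, 2}} = (\<lambda>e. \<phi> ` e) ` (\<lambda>x. {c, x}) ` L"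
    using L assms(2) by (auto simp: \<phi>_def insert_commute)
  ultimately show ?thesis
    by (auto simp: graph_iso_def star_def edges_path_graph_3)
qed

text \<open>The preimage of the centre \<open>0\<close> lies on every edge. Fixing it by
  \<open>the_inv_into\<close> makes the witness the same for all edges.\<close>

lemma graph_iso_star_graphD:
  assumes "simple_graph B" "graph_iso B (star_graph k)"
  shows "\<exists>c. \<forall>e\<in>edges B. c \<in> e"
proof -
  obtain \<phi> where \<phi>: "bij_betw \<phi> (verts B) {..k}"
    and E: "{{0, i} |i. 1 \<le> i \<and> i \<le> k} = (\<lambda>e. \<phi> ` e) ` edges B"
    using assms(2) by (auto simp: graph_iso_def star_graph_def)
  have "the_inv_into (verts B) \<phi> 0 \<in> e" if "e \<in> edges B" for e
  proof -
    have "\<phi> ` e \<in> {{0, i} |i. 1 \<le> i \<and> i \<le> k}"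
      using that E by blast
    then have "0 \<in> \<phi> ` e" by blast
    then obtain c where c: "c \<in> e" "\<phi> c = 0" by auto
    then have "c \<in> verts B"
      using assms(1) that by (auto simp: simple_graph_def)
    then have "the_inv_into (verts B) \<phi> 0 = c"
      using \<phi> c(2) by (metis bij_betw_def the_inv_into_f_f)
    then show ?thesis using c by simp
  qed
  then show ?thesis by blast
qed

lemma card_edges_graph_iso:
  assumes "simple_graph B" "graph_iso B H"
  shows "card (edges B) = card (edges H)"
proof -
  obtain \<phi> where \<phi>: "inj_on \<phi> (verts B)" "edges H = (\<lambda>e. \<phi> ` e) ` edges B"
    using assms(2) by (auto simp: graph_iso_def bij_betw_def)
  have "inj_on (\<lambda>e. \<phi> ` e) (Pow (verts B))"
    using \<phi>(1) by (rule inj_on_image_Pow)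
  then have "inj_on (\<lambda>e. \<phi> ` e) (edges B)"
    using assms(1) by (auto simp: simple_graph_def intro: inj_on_subset)
  then show ?thesis using \<phi>(2) by (simp add: card_image)
qed

lemma card_edges_path_block:
  assumes "simple_graph B" "graph_iso B (path_graph 3)"
  shows "card (edges B) = 2"
  using card_edges_graph_iso[OF assms] by (simp add: edges_path_graph_3 doubleton_eq_iff)

section \<open>Parity of the number of edges\<close>

lemma finite_edges:
  assumes "simple_graph G"
  shows "finite (edges G)"
  using assms by (auto simp: simple_graph_def intro: finite_subset[of _ "Pow (verts G)"])

text \<open>Each block contributes two edges. This gives the necessary congruence on
  \<open>n\<close> and also the parity of the edge set used up by a partial design.\<close>

lemma even_card_edges_if_path_design:
  assumes "simple_graph K" "is_design K (path_graph 3) \<B>"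
  shows "even (card (edges K))"
proof -
  have B: "card (edges B) = 2" "edges B \<subseteq> edges K" if "B \<in> \<B>" for B
    using assms(2) that card_edges_path_block by (auto simp: is_design_def subgraph_def)
  have disj: "disjoint_family_on edges \<B>" and U: "(\<Union>B\<in>\<B>. edges B) = edges K"
    using assms(2) by (auto simp: is_design_def)
  \<comment> \<open>A design is not finite by definition. Blocks have edges, so disjointness makes
    distinct blocks have distinct edge sets, which are subsets of a finite set.\<close>
  have "inj_on edges \<B>"
  proof (rule inj_onI)
    fix A B assume *: "A \<in> \<B>" "B \<in> \<B>" "edges A = edges B"
    then have "edges A \<inter> edges B \<noteq> {}" using B(1)[of A] by auto
    then show "A = B" using disj * by (auto simp: disjoint_family_on_def)
  qed
  moreover have "finite (edges ` \<B>)"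
    using B(2) finite_edges[OF assms(1)] by (auto intro: finite_subset[of _ "Pow (edges K)"])
  ultimately have fin: "finite \<B>" by (simp add: finite_image_iff)
  have "card (edges K) = (\<Sum>B\<in>\<B>. card (edges B))"
    unfolding U[symmetric]
    using fin disj B(1) by (intro card_UN_disjoint) (auto simp: disjoint_family_on_def intro: card_ge_0_finite)
  also have "\<dots> = card \<B> * 2" using B(1) by simp
  finally show ?thesis by simp
qed

lemma edges_complete_graph: "edges (complete_graph W) = {e. e \<subseteq> W \<and> card e = 2}"
  by (simp add: complete_graph_def)

lemma simple_graph_complete: "finite W \<Longrightarrow> simple_graph (complete_graph W)"
  by (simp add: complete_graph_def simple_graph_def)

text \<open>Translates the congruence of the theorem into the parity of \<open>n choose 2\<close>,
  computed for each residue of \<open>n\<close> modulo 4.\<close>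

lemma even_card_edges_complete_iff:
  assumes "finite W"
  shows "even (card (edges (complete_graph W))) \<longleftrightarrow> [card W = 0] (mod 4) \<or> [card W = 1] (mod 4)"
proof -
  let ?n = "card W"
  have "card (edges (complete_graph W)) = ?n choose 2"
    using assms by (simp add: edges_complete_graph n_subsets)
  moreover have "even (?n choose 2) \<longleftrightarrow> ?n mod 4 = 0 \<or> ?n mod 4 = 1"
  proof -
    define q where "q = ?n div 4"
    consider "?n = 4 * q" | "?n = 4 * q + 1" | "?n = 4 * q + 2" | "?n = 4 * q + 3"
      unfolding q_def by linarith
    then show ?thesis
    proof cases
      case 1
      then have "?n * (?n - 1) div 2 = 2 * (q * (4 * q - 1))" by simp
      then show ?thesis using 1 by (simp add: choose_two)
    next
      case 2
      then have "?n * (?n - 1) div 2 = 2 * (q * (4 * q + 1))" by simp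
      then show ?thesis using 2 by (simp add: choose_two)
    next
      case 3
      then have "?n * (?n - 1) div 2 = (2 * q + 1) * (4 * q + 1)" by (simp add: algebra_simps)
      moreover have "?n mod 4 = 2" unfolding 3 by presburger
      ultimately show ?thesis by (simp add: choose_two)
    next
      case 4
      then have "?n * (?n - 1) = 2 * ((4 * q + 3) * (2 * q + 1))" by (simp add: algebra_simps)
      then have "?n * (?n - 1) div 2 = (4 * q + 3) * (2 * q + 1)" by simp
      moreover have "?n mod 4 = 3" unfolding 4 by presburger
      ultimately show ?thesis by (simp add: choose_two)
    qed
  qed
  ultimately show ?thesis by (simp add: cong_def)
qed

section \<open>Building designs from stars\<close>

text \<open>Sets of size \<open>j\<close> are split off one at a time. It cuts out-neighbourhoods
  into leaf sets, with \<open>j = k\<close> for stars and \<open>j = 2\<close> for paths.\<close>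

lemma ex_partition_card:
  fixes S :: "'a set"
  assumes "finite S" "0 < j" "j dvd card S"
  shows "\<exists>Q. \<Union>Q = S \<and> disjoint Q \<and> (\<forall>L\<in>Q. card L = j)"
  using assms
proof (induction "card S" arbitrary: S rule: less_induct)
  case less
  show ?case
  proof (cases "S = {}")
    case True
    then show ?thesis by (intro exI[of _ "{}"]) auto
  next
    case False
    then have "j \<le> card S"
      using less.prems by (simp add: card_gt_0_iff dvd_imp_le)
    then obtain L where L: "L \<subseteq> S" "card L = j" "finite L"
      using less.prems(1) by (metis obtain_subset_with_card_n)
    then have c: "card (S - L) = card S - j"
      using less.prems(1) by (simp add: card_Diff_subset)
    then have "card (S - L) < card S" using \<open>j \<le> card S\<close> less.prems(2) by simp
    moreover have "j dvd card (S - L)" using c less.prems(3) by (simp add: dvd_diff_nat)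
    ultimately obtain Q where Q: "\<Union>Q = S - L" "disjoint Q" "\<forall>L\<in>Q. card L = j"
      using less.hyps[of "S - L"] less.prems by auto
    have "disjoint (insert L Q)"
      using Q by (auto simp: disjoint_def)
    then show ?thesis using Q L by (intro exI[of _ "insert L Q"]) auto
  qed
qed

text \<open>With \<open>H\<close> left open, this serves stars and paths alike. Blocks could share
  an edge only from a common centre, which \<open>disj\<close> excludes, or from its opposite ends,
  which \<open>anti\<close> excludes.\<close>

lemma is_design_stars:
  assumes "finite V"
    and Q: "\<And>c L. c \<in> V \<Longrightarrow> L \<in> Q c \<Longrightarrow> L \<subseteq> V - {c} \<and> graph_iso (star c L) H"
    and disj: "\<And>c. c \<in> V \<Longrightarrow> disjoint (Q c)"
    and anti: "\<And>x y. x \<in> V \<Longrightarrow> y \<in> V \<Longrightarrow> x \<in> \<Union>(Q y) \<Longrightarrow> y \<notin> \<Union>(Q x)"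
  shows "is_design (Graph V (\<Union>c\<in>V. (\<lambda>x. {c, x}) ` \<Union>(Q c))) H (\<Union>c\<in>V. star c ` Q c)"
    (is "is_design ?K H ?B")
proof -
  have sK: "simple_graph ?K"
    unfolding simple_graph_def using assms(1) Q by (force simp: card_insert_if)
  have "subgraph B ?K \<and> graph_iso B H" if "B \<in> ?B" for B
  proof -
    obtain c L where cL: "c \<in> V" "L \<in> Q c" "B = star c L" using \<open>B \<in> ?B\<close> by auto
    then have "simple_graph B"
      using Q[of c L] assms(1) by (auto intro!: simple_graph_star intro: finite_subset)
    then show ?thesis
      using cL Q[of c L] sK by (auto simp: subgraph_def star_def)
  qed
  moreover have "disjoint_family_on edges ?B"
    unfolding disjoint_family_on_def
  proof (intro ballI impI)
    fix A B assume "A \<in> ?B" "B \<in> ?B" "A \<noteq> B"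
    then obtain c L d M where A: "c \<in> V" "L \<in> Q c" "A = star c L"
      and B: "d \<in> V" "M \<in> Q d" "B = star d M" by blast
    have False if e: "e \<in> edges A" "e \<in> edges B" for e
    proof -
      obtain x y where x: "x \<in> L" "e = {c, x}" and y: "y \<in> M" "e = {d, y}"
        using e A B by (auto simp: star_def)
      consider "c = d" "x = y" | "c = y" "x = d" using x y by (auto simp: doubleton_eq_iff)
      then show False
      proof cases
        case 1
        then have "L = M" using disj[of c] A B x y by (auto simp: disjoint_def)
        then show False using 1 A B \<open>A \<noteq> B\<close> by simp
      next
        case 2
        then show False using anti[of d c] A B x y by blast
      qed
    qed
    then show "edges A \<inter> edges B = {}" by blast
  qed
  moreover have "(\<Union>B\<in>?B. edges B) = edges ?K"
    by (auto simp: star_def)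
  ultimately show ?thesis unfolding is_design_def by blast
qed

lemma is_design_Un:
  assumes 1: "is_design (Graph V E) H \<A>" and 2: "is_design (Graph V F) H \<B>"
    and "E \<inter> F = {}" and s: "simple_graph (Graph V (E \<union> F))"
  shows "is_design (Graph V (E \<union> F)) H (\<A> \<union> \<B>)"
proof -
  have U: "(\<Union>B\<in>\<A>. edges B) = E" "(\<Union>B\<in>\<B>. edges B) = F"
    using 1 2 by (auto simp: is_design_def)
  have "subgraph B (Graph V (E \<union> F)) \<and> graph_iso B H" if "B \<in> \<A> \<union> \<B>" for B
    using that 1 2 s unfolding is_design_def subgraph_def by auto
  moreover have "edges A \<inter> edges B = {}" if "A \<in> \<A> \<union> \<B>" "B \<in> \<A> \<union> \<B>" "A \<noteq> B" for A B
  proof -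
    have sub: "edges C \<subseteq> E" if "C \<in> \<A>" for C using U(1) that by blast
    have sub': "edges C \<subseteq> F" if "C \<in> \<B>" for C using U(2) that by blast
    have same: "edges A \<inter> edges B = {}" if "A \<in> \<A> \<and> B \<in> \<A> \<or> A \<in> \<B> \<and> B \<in> \<B>"
      using that 1 2 \<open>A \<noteq> B\<close> unfolding is_design_def disjoint_family_on_def by meson
    show ?thesis
    \<comment> \<open>The hypotheses allow an edgeless block in both families, so the split is on
      membership in \<open>\<A>\<close> alone.\<close>
    proof (cases "A \<in> \<A> \<longleftrightarrow> B \<in> \<A>")
      case True
      then show ?thesis using same that(1,2) by fast
    next
      case False
      then have "edges A \<subseteq> E \<and> edges B \<subseteq> F \<or> edges A \<subseteq> F \<and> edges B \<subseteq> E"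
        using sub sub' that(1,2) by fast
      then show ?thesis using \<open>E \<inter> F = {}\<close> by blast
    qed
  qed
  moreover have "(\<Union>B\<in>\<A> \<union> \<B>. edges B) = edges (Graph V (E \<union> F))"
    using U by auto
  ultimately show ?thesis
    unfolding is_design_def disjoint_family_on_def by blast
qed

section \<open>Decomposing connected graphs into paths with two edges\<close>

lemma odd_card_sym_diff:
  assumes "finite A" "finite B"
  shows "odd (card (sym_diff A B)) \<longleftrightarrow> odd (card A) \<noteq> odd (card B)"
proof -
  have "card A = card (A - B) + card (A \<inter> B)" "card B = card (B - A) + card (A \<inter> B)"
    using assms by (metis Int_commute card_Diff_subset_Int card_mono finite_Int inf_le1 le_add_diff_inverse2)+
  moreover have "card (sym_diff A B) = card (A - B) + card (B - A)"
    using assms by (intro card_Un_disjoint) auto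
  ultimately show ?thesis by auto
qed

text \<open>An orientation is encoded by the function \<open>t\<close> choosing the tail of every edge. Flipping the
  edges of a walk changes the out-degree parity exactly at its two ends, so an orientation with as
  few odd out-degrees as possible has none.\<close>

lemma ex_even_orientation:
  assumes W: "finite W" and E: "\<And>e. e \<in> E \<Longrightarrow> e \<subseteq> W \<and> card e = 2"
    and ev: "even (card E)"
    and conn: "\<And>w. w \<in> W \<Longrightarrow> (w, r) \<in> {(a, b). {a, b} \<in> E}\<^sup>*"
  shows "\<exists>t. (\<forall>e\<in>E. t e \<in> e) \<and> (\<forall>w. even (card {e \<in> E. t e = w}))"
proof -
  define odds where "odds t = {w. odd (card {e \<in> E. t e = w})}" for t :: "'a set \<Rightarrow> 'a"
  define T where "T = {t. \<forall>e\<in>E. t e \<in> e}"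
  let ?R = "{(a, b). {a, b} \<in> E}"
  have finE: "finite E" using W E by (auto intro: finite_subset[of _ "Pow W"])
  have OW: "odds t \<subseteq> W" if "t \<in> T" for t
  proof
    fix w assume "w \<in> odds t"
    then have "{e \<in> E. t e = w} \<noteq> {}" by (intro notI) (simp add: odds_def)
    then show "w \<in> W" using that E by (auto simp: T_def)
  qed
  \<comment> \<open>\<open>sym_diff {a} {b}\<close> replaces \<open>{a, b}\<close> because a closed
    walk must change nothing.\<close>
  have walk: "\<exists>t'\<in>T. odds t' = sym_diff (odds t) (sym_diff {a} {b})" if "(a, b) \<in> ?R\<^sup>*" "t \<in> T" for a b t
    using that(1)
  proof (induction rule: rtrancl_induct)
    case base
    then show ?case using that(2) by auto
  next
    case (step b c)
    then obtain t' where t': "t' \<in> T" "odds t' = sym_diff (odds t) (sym_diff {a} {b})" by blast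
    have e: "{b, c} \<in> E" using step by simp
    then have "b \<noteq> c" using E[OF e] by auto
    \<comment> \<open>The last edge of the walk is reversed, which changes the parity at
      \<open>b\<close> and \<open>c\<close> only.\<close>
    define s where "s = t'({b, c} := (if t' {b, c} = b then c else b))"
    have "s \<in> T" using t'(1) by (auto simp: s_def T_def)
    have tb: "t' {b, c} = b \<or> t' {b, c} = c" using t'(1) e by (auto simp: T_def)
    have "odds s = sym_diff (odds t') {b, c}"
    proof -
      have "w \<in> odds s \<longleftrightarrow> (w \<in> odds t') \<noteq> (w \<in> {b, c})" for w
      proof (cases "w \<in> {b, c}")
        case True
        have "{e \<in> E. s e = w} = sym_diff {e \<in> E. t' e = w} {{b, c}}"
          using True tb e \<open>b \<noteq> c\<close> by (auto simp: s_def)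
        then show ?thesis using True finE odd_card_sym_diff[of "{e \<in> E. t' e = w}" "{{b, c}}"]
          by (simp add: odds_def)
      next
        case False
        then have "{e \<in> E. s e = w} = {e \<in> E. t' e = w}"
          using tb by (auto simp: s_def)
        then show ?thesis using False by (simp add: odds_def)
      qed
      then show ?thesis by blast
    qed
    also have "\<dots> = sym_diff (odds t) (sym_diff {a} {c})"
      using t'(2) \<open>b \<noteq> c\<close> by auto
    finally show ?case using \<open>s \<in> T\<close> by blast
  qed
  have "T \<noteq> {}"
  proof -
    have "e \<noteq> {}" if "e \<in> E" for e using E[OF that] by auto
    then have "(\<lambda>e. SOME x. x \<in> e) \<in> T" by (simp add: T_def some_in_eq)
    then show ?thesis by blast
  qed
  then obtain t where t: "t \<in> T" and min: "\<And>s. s \<in> T \<Longrightarrow> card (odds t) \<le> card (odds s)"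
    using ex_has_least_nat[of "\<lambda>t. t \<in> T" _ "\<lambda>t. card (odds t)"] by blast
  have fin: "finite (odds t)" using OW[OF t] W by (rule finite_subset)
  have "odds t = {}"
  proof (rule ccontr)
    assume "odds t \<noteq> {}"
    \<comment> \<open>Out-degrees sum to the even number \<open>card E\<close>, so the number of odd
      ones is even. If one is odd, a second exists, and a walk between the two removes both.\<close>
    have "card E = (\<Sum>w\<in>W. card {e \<in> E. t e = w})"
    proof -
      have "E = (\<Union>w\<in>W. {e \<in> E. t e = w})" using t E by (auto simp: T_def)
      then have "card E = card (\<Union>w\<in>W. {e \<in> E. t e = w})" by simp
      also have "\<dots> = (\<Sum>w\<in>W. card {e \<in> E. t e = w})"
        using W finE by (intro card_UN_disjoint) auto
      finally show ?thesis .
    qed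
    then have "even (card {w \<in> W. odd (card {e \<in> E. t e = w})})"
      using ev W by (simp add: even_sum_iff)
    moreover have "{w \<in> W. odd (card {e \<in> E. t e = w})} = odds t"
      using OW[OF t] by (auto simp: odds_def)
    ultimately have "even (card (odds t))" by simp
    then have "card (odds t) \<noteq> 1" by auto
    then obtain a b where ab: "a \<in> odds t" "b \<in> odds t" "a \<noteq> b"
      using \<open>odds t \<noteq> {}\<close> by (metis is_singletonI' is_singleton_altdef)
    have "sym ?R" by (auto simp: sym_def insert_commute)
    then have "sym (?R\<^sup>*)" by (rule sym_rtrancl)
    then have "(a, b) \<in> ?R\<^sup>*"
      using conn[of a] conn[of b] ab OW[OF t] by (meson rtrancl_trans subsetD symD)
    then obtain s where s: "s \<in> T" "odds s = sym_diff (odds t) (sym_diff {a} {b})"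
      using walk t by blast
    then have "odds s = odds t - {a, b}" using ab by auto
    then have "card (odds s) < card (odds t)" using ab fin by (intro psubset_card_mono) auto
    then show False using min[OF s(1)] by simp
  qed
  then show ?thesis using t by (auto simp: T_def odds_def)
qed

text \<open>In an orientation with even out-degrees, the out-edges at each vertex are paired off,
  and each pair is a path with that vertex in the middle.\<close>

lemma ex_path_design:
  assumes W: "finite W" and E: "\<And>e. e \<in> E \<Longrightarrow> e \<subseteq> W \<and> card e = 2"
    and "even (card E)"
    and "\<And>w. w \<in> W \<Longrightarrow> (w, r) \<in> {(a, b). {a, b} \<in> E}\<^sup>*"
  shows "\<exists>\<B>. is_design (Graph W E) (path_graph 3) \<B>"
proof -
  obtain t where t: "\<And>e. e \<in> E \<Longrightarrow> t e \<in> e" "\<And>w. even (card {e \<in> E. t e = w})"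
    using ex_even_orientation[OF assms] by blast
  define N where "N w = {x. {w, x} \<in> E \<and> t {w, x} = w}" for w
  have eq: "{e \<in> E. t e = w} = (\<lambda>x. {w, x}) ` N w" for w
  proof -
    have "e \<in> (\<lambda>x. {w, x}) ` N w" if "e \<in> E" "t e = w" for e
    proof -
      have "w \<in> e" "card e = 2" using t(1)[of e] E that by auto
      then obtain x where "e = {w, x}" by (auto simp: card_2_iff)
      then show ?thesis using that by (auto simp: N_def)
    qed
    then show ?thesis by (auto simp: N_def)
  qed
  have NW: "N w \<subseteq> W - {w}" for w
    using E by (fastforce simp: N_def)
  have "even (card (N w))" for w
  proof -
    have "inj_on (\<lambda>x. {w, x}) (N w)" by (auto simp: inj_on_def doubleton_eq_iff)
    then show ?thesis using t(2)[of w] eq[of w] by (simp add: card_image)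
  qed
  then have "\<exists>Q. \<Union>Q = N w \<and> disjoint Q \<and> (\<forall>L\<in>Q. card L = 2)" for w
    using NW[of w] W by (intro ex_partition_card) (auto intro: finite_subset)
  then obtain Q where Q: "\<And>w. \<Union>(Q w) = N w" "\<And>w. disjoint (Q w)" "\<And>w L. L \<in> Q w \<Longrightarrow> card L = 2"
    by metis
  have "is_design (Graph W (\<Union>c\<in>W. (\<lambda>x. {c, x}) ` \<Union>(Q c))) (path_graph 3) (\<Union>c\<in>W. star c ` Q c)"
  proof (rule is_design_stars)
    fix c L assume "L \<in> Q c"
    then have "L \<subseteq> W - {c}" using Q(1) NW by blast
    then show "L \<subseteq> W - {c} \<and> graph_iso (star c L) (path_graph 3)"
      using Q(3) \<open>L \<in> Q c\<close> by (blast intro: graph_iso_star_path)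
  next
    fix x y assume "x \<in> \<Union>(Q y)"
    then have "x \<in> N y" "x \<noteq> y" using Q(1) NW by auto
    then show "y \<notin> \<Union>(Q x)" using Q(1) by (auto simp: N_def insert_commute)
  qed (use W Q in auto)
  moreover have "(\<Union>c\<in>W. (\<lambda>x. {c, x}) ` \<Union>(Q c)) = E"
  proof -
    have "(\<Union>c\<in>W. (\<lambda>x. {c, x}) ` \<Union>(Q c)) = (\<Union>c\<in>W. {e \<in> E. t e = c})"
      using Q(1) eq by simp
    also have "\<dots> = E" using t(1) E by blast
    finally show ?thesis .
  qed
  ultimately show ?thesis by auto
qed

section \<open>From an orientation with a sink to a down-link\<close>

text \<open>An orientation of the complete graph on \<open>V\<close> with sink \<open>z\<close>, given by its out-neighbourhoods. The
  edges from each nonzero vertex to a smaller out-neighbour are kept out of the down-link; they form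
  a tree spanning \<open>V - {z}\<close>.\<close>

definition sink_orientation :: "nat \<Rightarrow> nat set \<Rightarrow> nat \<Rightarrow> (nat \<Rightarrow> nat set) \<Rightarrow> bool" where
  "sink_orientation k V z N \<longleftrightarrow>
     finite V \<and> z \<in> V \<and> 0 \<in> V \<and> z \<noteq> 0 \<and> N z = {} \<and>
     (\<forall>c\<in>V. N c \<subseteq> V - {c} \<and> k dvd card (N c)) \<and>
     (\<forall>x\<in>V. \<forall>y\<in>V. x \<noteq> y \<longrightarrow> (x \<in> N y \<longleftrightarrow> y \<notin> N x)) \<and>
     (\<forall>c\<in>V - {z, 0}. \<exists>d\<in>N c. d < c \<and> d \<noteq> z)"

text \<open>The second vertex set \<open>W\<close> is \<open>V - {z}\<close> enlarged to size
  \<open>n\<close>. The paths chosen inside the stars have edge set \<open>E\<close>, and the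
  remaining edges \<open>F\<close> are decomposed by \<open>ex_path_design\<close>.\<close>

lemma L1_if_sink_orientation:
  assumes so: "sink_orientation k V z N" and k: "3 < k"
    and n: "card V - 1 \<le> n" "[n = 0] (mod 4) \<or> [n = 1] (mod 4)"
  shows "n \<in> L1 (star_graph k) (card V)"
proof -
  have V: "finite V" "z \<in> V" "0 \<in> V" "z \<noteq> 0" and Nz: "N z = {}"
    and N: "\<And>c. c \<in> V \<Longrightarrow> N c \<subseteq> V - {c}" and kN: "\<And>c. c \<in> V \<Longrightarrow> k dvd card (N c)"
    and tour: "\<And>x y. x \<in> V \<Longrightarrow> y \<in> V \<Longrightarrow> x \<noteq> y \<Longrightarrow> x \<in> N y \<longleftrightarrow> y \<notin> N x"
    and red: "\<And>c. c \<in> V - {z, 0} \<Longrightarrow> \<exists>d\<in>N c. d < c \<and> d \<noteq> z"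
    using so unfolding sink_orientation_def by blast+
  \<comment> \<open>\<open>r c\<close> is the reserved neighbour of \<open>c\<close>; the edges
    \<open>{c, r c}\<close> will form the spanning tree.\<close>
  obtain r where r: "\<And>c. c \<in> V - {z, 0} \<Longrightarrow> r c \<in> N c \<and> r c < c \<and> r c \<noteq> z"
    using red by metis
  have "\<exists>Q. \<Union>Q = N c \<and> disjoint Q \<and> (\<forall>L\<in>Q. card L = k)" if "c \<in> V" for c
    using N[OF that] kN[OF that] V(1) k by (intro ex_partition_card) (auto intro: finite_subset)
  then obtain Q where Q: "\<And>c. c \<in> V \<Longrightarrow> \<Union>(Q c) = N c" "\<And>c. c \<in> V \<Longrightarrow> disjoint (Q c)"
    "\<And>c L. c \<in> V \<Longrightarrow> L \<in> Q c \<Longrightarrow> card L = k"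
    by metis
  have QV: "L \<subseteq> V - {c}" if "c \<in> V" "L \<in> Q c" for c L
    using Q(1) N that by blast
  have anti: "y \<notin> \<Union>(Q x)" if "x \<in> V" "y \<in> V" "x \<in> \<Union>(Q y)" for x y
    using that Q(1) tour[of x y] N[of x] by auto
  let ?B = "\<Union>c\<in>V. star c ` Q c"
  have "is_design (Graph V (\<Union>c\<in>V. (\<lambda>x. {c, x}) ` \<Union>(Q c))) (star_graph k) ?B"
  proof (rule is_design_stars)
    fix c L assume cL: "c \<in> V" "L \<in> Q c"
    then have "L \<subseteq> V - {c}" by (rule QV)
    then show "L \<subseteq> V - {c} \<and> graph_iso (star c L) (star_graph k)"
      using graph_iso_star_graph[of L c] Q(3)[OF cL] V(1) by (auto intro: finite_subset)
  qed (use V Q anti in auto)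
  moreover have "Graph V (\<Union>c\<in>V. (\<lambda>x. {c, x}) ` \<Union>(Q c)) = complete_graph V"
  proof -
    have "{x, y} \<in> (\<Union>c\<in>V. (\<lambda>x. {c, x}) ` N c)" if "x \<in> V" "y \<in> V" "x \<noteq> y" for x y
    proof (cases "x \<in> N y")
      case True
      then show ?thesis using that by (auto simp: insert_commute)
    next
      case False
      then show ?thesis using that tour[of x y] by auto
    qed
    moreover have "{c, x} \<subseteq> V \<and> card {c, x} = 2" if "c \<in> V" "x \<in> N c" for c x
      using that N[of c] by (auto simp: card_insert_if)
    ultimately have "(\<Union>c\<in>V. (\<lambda>x. {c, x}) ` N c) = {e. e \<subseteq> V \<and> card e = 2}"
      by (fastforce simp: card_2_iff)
    then show ?thesis using Q(1) by (simp add: complete_graph_def)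
  qed
  ultimately have B: "is_design (complete_graph V) (star_graph k) ?B" by simp

  \<comment> \<open>Here \<open>k \<ge> 4\<close> enters: a leaf set keeps two elements after
    \<open>z\<close> and \<open>r c\<close> are removed.\<close>
  have "\<exists>P. P \<subseteq> L - {z, r c} \<and> card P = 2" if "c \<in> V" "L \<in> Q c" for c L
  proof -
    have "finite L" using QV[OF that] V(1) by (auto intro: finite_subset)
    then have "card L - card {z, r c} \<le> card (L - {z, r c})"
      by (intro diff_card_le_card_Diff) auto
    moreover have "card {z, r c} \<le> 2" by (simp add: card_insert_if)
    ultimately have "2 \<le> card (L - {z, r c})" using Q(3)[OF that] k by linarith
    then show ?thesis by (meson obtain_subset_with_card_n)
  qed
  then obtain P where P: "\<And>c L. c \<in> V \<Longrightarrow> L \<in> Q c \<Longrightarrow> P c L \<subseteq> L - {z, r c} \<and> card (P c L) = 2"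
    by metis
  let ?U = "V - {z}"
  \<comment> \<open>The extra vertices only have to avoid \<open>V - {z}\<close>, so
    \<open>z\<close> itself may be among them.\<close>
  have "infinite (- ?U)" using V(1) by (simp add: finite_compl)
  then obtain T where T: "finite T" "card T = n - card ?U" "T \<subseteq> - ?U"
    by (metis infinite_arbitrarily_large)
  define W where "W = ?U \<union> T"
  have cardU: "card ?U = card V - 1" using V by simp
  have W: "finite W" "?U \<subseteq> W" using T V(1) by (auto simp: W_def)
  have cardW: "card W = n"
  proof -
    have "card W = card ?U + card T" unfolding W_def using T V(1) by (intro card_Un_disjoint) auto
    then show ?thesis using T(2) cardU n(1) by simp
  qed
  define R where "R c = (if c \<in> ?U then P c ` Q c else {})" for c
  let ?A = "\<Union>c\<in>W. star c ` R c"
  define E where "E = (\<Union>c\<in>W. (\<lambda>x. {c, x}) ` \<Union>(R c))"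
  define F where "F = edges (complete_graph W) - E"
  have RD: "c \<in> ?U \<and> x \<in> ?U \<and> x \<in> N c \<and> x \<noteq> r c" if "x \<in> \<Union>(R c)" for x c
  proof -
    obtain L where L: "c \<in> ?U" "L \<in> Q c" "x \<in> P c L"
      using \<open>x \<in> \<Union>(R c)\<close> by (auto simp: R_def split: if_splits)
    then have "x \<in> L" "x \<noteq> z" "x \<noteq> r c" using P[of c L] by auto
    then show ?thesis using L QV[of c L] Q(1)[of c] by auto
  qed
  have A: "is_design (Graph W E) (path_graph 3) ?A"
    unfolding E_def
  proof (rule is_design_stars)
    show "finite W" by (rule W(1))
  next
    fix c M assume "c \<in> W" "M \<in> R c"
    then obtain L where L: "c \<in> ?U" "L \<in> Q c" "M = P c L"
      by (auto simp: R_def split: if_splits)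
    have "M \<subseteq> W - {c}"
      using RD[of _ c] \<open>M \<in> R c\<close> W(2) N[of c] by blast
    then show "M \<subseteq> W - {c} \<and> graph_iso (star c M) (path_graph 3)"
      using L P[of c L] by (auto intro: graph_iso_star_path)
  next
    fix c
    have "P c L \<inter> P c M = {}" if "c \<in> ?U" "L \<in> Q c" "M \<in> Q c" "L \<noteq> M" for L M
    proof -
      have "L \<inter> M = {}" using that Q(2)[of c] by (simp add: disjoint_def)
      then show ?thesis using that P[of c L] P[of c M] by blast
    qed
    then show "disjoint (R c)" by (auto simp: R_def disjoint_def)
  next
    fix x y assume "x \<in> \<Union>(R y)"
    then show "y \<notin> \<Union>(R x)" using RD[of x y] RD[of y x] tour[of x y] N[of x] by blast
  qed
  have sE: "simple_graph (Graph W E)"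
  proof -
    have "{c, x} \<subseteq> W \<and> card {c, x} = 2" if "x \<in> \<Union>(R c)" for c x
      using RD[OF that] N[of c] W(2) by (auto simp: card_insert_if)
    then show ?thesis using W(1) unfolding simple_graph_def E_def by auto
  qed
  have EW: "E \<subseteq> edges (complete_graph W)"
    using sE by (auto simp: simple_graph_def edges_complete_graph)
  have "\<exists>\<B>. is_design (Graph W F) (path_graph 3) \<B>"
  proof (rule ex_path_design[where r = 0])
    show "finite W" by (rule W(1))
    show "e \<subseteq> W \<and> card e = 2" if "e \<in> F" for e
      using that by (auto simp: F_def edges_complete_graph)
    have "even (card (edges (complete_graph W)))"
      using n(2) cardW even_card_edges_complete_iff[OF W(1)] by simp
    moreover have "even (card E)"
      using even_card_edges_if_path_design[OF sE A] by simp
    moreover have "card F = card (edges (complete_graph W)) - card E"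
      unfolding F_def using EW finite_edges[OF sE] by (intro card_Diff_subset) auto
    ultimately show "even (card F)" by simp
  next
    let ?S = "{(a, b). {a, b} \<in> F}"
    \<comment> \<open>Following \<open>r\<close> strictly decreases the vertex and avoids
      \<open>z\<close>, so it ends at \<open>0\<close>.\<close>
    have tree: "(c, 0) \<in> ?S\<^sup>*" if "c \<in> ?U" for c
      using that
    proof (induction c rule: less_induct)
      case (less c)
      show ?case
      proof (cases "c = 0")
        case False
        then have rc: "r c \<in> N c" "r c < c" "r c \<noteq> z" using r[of c] less.prems by auto
        then have rU: "r c \<in> ?U" using N[of c] less.prems by auto
        have "{c, r c} \<notin> E"
        proof
          assume "{c, r c} \<in> E"
          then obtain d x where dx: "x \<in> \<Union>(R d)" "{c, r c} = {d, x}" by (auto simp: E_def)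
          then consider "d = c" "x = r c" | "d = r c" "x = c" by (auto simp: doubleton_eq_iff)
          then show False
          \<comment> \<open>In the first case \<open>r c\<close> would be a chosen leaf at
            \<open>c\<close>; in the second the edge would also be oriented from \<open>r c\<close>
            to \<open>c\<close>.\<close>
          proof cases
            case 1
            then show False using RD[OF dx(1)] by simp
          next
            case 2
            then have "c \<in> N (r c)" using RD[OF dx(1)] by simp
            then show False using tour[of c "r c"] rc rU less.prems by simp
          qed
        qed
        moreover have "{c, r c} \<in> edges (complete_graph W)"
          using rU less.prems rc(2) W(2) by (auto simp: edges_complete_graph card_insert_if)
        ultimately have "(c, r c) \<in> ?S" by (simp add: F_def)
        moreover have "(r c, 0) \<in> ?S\<^sup>*" using less.IH[OF rc(2) rU] .
        ultimately show ?thesis by (rule converse_rtrancl_into_rtrancl)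
      qed simp
    qed
    show "(w, 0) \<in> ?S\<^sup>*" if "w \<in> W" for w
    proof (cases "w \<in> ?U")
      case True
      then show ?thesis by (rule tree)
    next
      case False
      \<comment> \<open>Edges of \<open>E\<close> stay inside \<open>?U\<close>, so a vertex outside
        \<open>?U\<close> keeps its edge to \<open>0\<close>.\<close>
      have "{w, 0} \<notin> E"
      proof
        assume "{w, 0} \<in> E"
        then obtain d x where "x \<in> \<Union>(R d)" "{w, 0} = {d, x}" by (auto simp: E_def)
        then show False using RD[of x d] False by (auto simp: doubleton_eq_iff)
      qed
      moreover have "{w, 0} \<in> edges (complete_graph W)"
      proof -
        have "w \<noteq> 0" using False V(3,4) by (intro notI) simp
        then show ?thesis
          using \<open>w \<in> W\<close> V W(2) by (auto simp: edges_complete_graph card_insert_if)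
      qed
      ultimately have "(w, 0) \<in> ?S" by (simp add: F_def)
      then show ?thesis by (rule r_into_rtrancl)
    qed
  qed
  then obtain \<D> where D: "is_design (Graph W F) (path_graph 3) \<D>" by blast
  have EF: "Graph W (E \<union> F) = complete_graph W"
    using EW by (auto simp: F_def complete_graph_def)
  have "is_design (Graph W (E \<union> F)) (path_graph 3) (?A \<union> \<D>)"
  proof (rule is_design_Un[OF A D])
    show "E \<inter> F = {}" by (simp add: F_def)
    show "simple_graph (Graph W (E \<union> F))" unfolding EF by (rule simple_graph_complete[OF W(1)])
  qed
  then have D': "is_design (complete_graph W) (path_graph 3) (?A \<union> \<D>)" using EF by simp
  have "\<forall>b\<in>?B. \<exists>b'. b' \<in> ?A \<union> \<D> \<and> subgraph b' b"
  proof
    fix b assume "b \<in> ?B"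
    obtain c L where cL: "c \<in> V" "L \<in> Q c" "b = star c L" using \<open>b \<in> ?B\<close> by auto
    \<comment> \<open>The sink has no out-neighbours, hence is the centre of no star, so every star
      has received a path.\<close>
    have "L \<noteq> {}" using Q(3)[OF cL(1,2)] k by auto
    then have "c \<in> ?U" using cL Q(1) Nz by auto
    then have "star c (P c L) \<in> ?A" using cL(2) W(2) by (auto simp: R_def)
    moreover have "subgraph (star c (P c L)) (star c L)"
      using QV[OF cL(1,2)] P[OF cL(1,2)] V(1) by (intro star_mono) (auto intro: finite_subset)
    ultimately show "\<exists>b'. b' \<in> ?A \<union> \<D> \<and> subgraph b' b" using cL(3) by blast
  qed
  from bchoice[OF this] obtain f where "\<forall>b\<in>?B. f b \<in> ?A \<union> \<D> \<and> subgraph (f b) b" ..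
  then have f: "down_link f ?B (?A \<union> \<D>)"
    by (simp only: down_link_def Pi_iff ball_conj_distrib)
  show ?thesis
    unfolding L1_def mem_Collect_eq
    by (intro exI conjI) (rule V(1) refl W(1) cardW B D' f)+
qed

section \<open>Explicit orientations for the four families of orders\<close>

text \<open>The rotational tournament on \<open>2 * h + 1\<close> vertices: \<open>i\<close> dominates its \<open>h\<close> cyclic predecessors. For
  \<open>i < h\<close> the truncation of \<open>i - h\<close> cuts off the wrapped-around part, which is the second interval.\<close>

definition rot :: "nat \<Rightarrow> nat \<Rightarrow> nat set" where
  "rot h i = {i - h..<i} \<union> {i + h + 1..<2 * h + 1}"

lemma rot_subset: "i < 2 * h + 1 \<Longrightarrow> rot h i \<subseteq> {..<2 * h + 1} - {i}"
  by (auto simp: rot_def)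

lemma card_rot:
  assumes "i < 2 * h + 1"
  shows "card (rot h i) = h"
proof -
  have "card (rot h i) = card {i - h..<i} + card {i + h + 1..<2 * h + 1}"
    unfolding rot_def by (intro card_Un_disjoint) auto
  then show ?thesis using assms by simp
qed

lemma rot_tournament:
  assumes "i < 2 * h + 1" "j < 2 * h + 1" "i \<noteq> j"
  shows "i \<in> rot h j \<longleftrightarrow> j \<notin> rot h i"
  using assms by (auto simp: rot_def)

lemma finite_rot: "finite (rot h i)"
  by (simp add: rot_def)

text \<open>Supplies the smaller out-neighbour required by \<open>sink_orientation\<close>.\<close>

lemma pred_in_rot: "0 < i \<Longrightarrow> 0 < h \<Longrightarrow> i - 1 \<in> rot h i"
  by (auto simp: rot_def)

text \<open>The rotational tournament on \<open>2 * k - 1\<close> vertices has out-degrees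
  \<open>k - 1\<close>; the edge to the sink raises them to \<open>k\<close>.\<close>

lemma sink_orientation_2k:
  assumes "1 < k"
  shows "sink_orientation k {..<2 * k} (2 * k - 1)
    (\<lambda>c. if c = 2 * k - 1 then {} else insert (2 * k - 1) (rot (k - 1) c))"
proof -
  let ?z = "2 * k - 1"
  have z: "2 * (k - 1) + 1 = ?z" using assms by simp
  have sub: "rot (k - 1) c \<subseteq> {..<?z} - {c}" if "c < ?z" for c
    using rot_subset[of c "k - 1"] that z by simp
  have crd: "card (insert ?z (rot (k - 1) c)) = k" if "c < ?z" for c
    using card_rot[of c "k - 1"] sub[OF that] that z assms finite_rot[of "k - 1" c]
    by (subst card_insert_disjoint) auto
  have tour: "i \<in> rot (k - 1) j \<longleftrightarrow> j \<notin> rot (k - 1) i" if "i < ?z" "j < ?z" "i \<noteq> j" for i j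
    using rot_tournament[of i "k - 1" j] that z by simp
  have lt: "c < ?z" if "c < 2 * k" "c \<noteq> ?z" for c using that by simp
  show ?thesis
    unfolding sink_orientation_def
  proof (intro conjI ballI impI)
    fix c assume "c \<in> {..<2 * k} - {?z, 0}"
    then have "c - 1 \<in> rot (k - 1) c" "c - 1 < c" "c - 1 \<noteq> ?z" "c \<noteq> ?z"
      using pred_in_rot[of c "k - 1"] assms by auto
    then show "\<exists>d\<in>if c = ?z then {} else insert ?z (rot (k - 1) c). d < c \<and> d \<noteq> ?z"
      by auto
  next
    fix c assume "c \<in> {..<2 * k}"
    then show "(if c = ?z then {} else insert ?z (rot (k - 1) c)) \<subseteq> {..<2 * k} - {c}"
      using sub[of c] lt[of c] by fastforce
  next
    fix c assume "c \<in> {..<2 * k}"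
    then show "k dvd card (if c = ?z then {} else insert ?z (rot (k - 1) c))"
      using crd[of c] lt[of c] by auto
  next
    fix x y assume "x \<in> {..<2 * k}" "y \<in> {..<2 * k}" "x \<noteq> y"
    then show "(x \<in> (if y = ?z then {} else insert ?z (rot (k - 1) y))) \<longleftrightarrow>
      (y \<notin> (if x = ?z then {} else insert ?z (rot (k - 1) x)))"
      using tour[of x y] lt[of x] lt[of y] by auto
  qed (use assms in auto)
qed

text \<open>The last \<open>k = 2 * h + 1\<close> vertices dominate those of \<open>sink_orientation_2k\<close> except \<open>{1..h}\<close>,
  which dominate them; this gives the new vertices and \<open>{1..h}\<close> out-degree \<open>2 * k\<close>.\<close>

lemma sink_orientation_3k:
  assumes k: "k = 2 * h + 1" and "0 < h"
  shows "\<exists>N. sink_orientation k {..<3 * k} (2 * k - 1) N"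
proof -
  let ?z = "2 * k - 1"
  define M where "M = (\<lambda>c. if c = 2 * k - 1 then {} else insert (2 * k - 1) (rot (k - 1) c))"
  have "sink_orientation k {..<2 * k} ?z M"
    unfolding M_def by (rule sink_orientation_2k) (use assms in simp)
  then have Mz: "M ?z = {}" and M: "\<And>c. c < 2 * k \<Longrightarrow> M c \<subseteq> {..<2 * k} - {c}"
    and kM: "\<And>c. c < 2 * k \<Longrightarrow> k dvd card (M c)"
    and tourM: "\<And>x y. x < 2 * k \<Longrightarrow> y < 2 * k \<Longrightarrow> x \<noteq> y \<Longrightarrow> x \<in> M y \<longleftrightarrow> y \<notin> M x"
    and redM: "\<And>c. c < 2 * k \<Longrightarrow> c \<noteq> ?z \<Longrightarrow> c \<noteq> 0 \<Longrightarrow> \<exists>d\<in>M c. d < c \<and> d \<noteq> ?z"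
    unfolding sink_orientation_def Ball_def lessThan_iff by blast+
  let ?C = "{2 * k..<3 * k}" and ?D = "{1..h}"
  \<comment> \<open>The new vertices carry a shifted rotational tournament with out-degrees
    \<open>h\<close>.\<close>
  define J where "J c = (\<lambda>i. 2 * k + i) ` rot h (c - 2 * k)" for c
  define N where "N c = (if c < 2 * k then M c \<union> (if c \<in> ?D then ?C else {})
    else ({..<2 * k} - ?D) \<union> J c)" for c
  have J: "J c \<subseteq> ?C - {c}" if "c \<in> ?C" for c
    using rot_subset[of "c - 2 * k" h] that k by (fastforce simp: J_def)
  have cardJ: "card (J c) = h" if "c \<in> ?C" for c
  proof -
    have "c - 2 * k < 2 * h + 1" using that k by auto
    then show ?thesis using card_rot by (simp add: J_def card_image inj_on_def)
  qed
  have memJ: "x \<in> J y \<longleftrightarrow> x - 2 * k \<in> rot h (y - 2 * k)" if "x \<in> ?C" for x y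
    using that by (force simp: J_def image_iff)
  have tourJ: "x \<in> J y \<longleftrightarrow> y \<notin> J x" if "x \<in> ?C" "y \<in> ?C" "x \<noteq> y" for x y
  proof -
    have "x - 2 * k < 2 * h + 1" "y - 2 * k < 2 * h + 1" "x - 2 * k \<noteq> y - 2 * k"
      using that k by auto
    then show ?thesis
      using rot_tournament[of "x - 2 * k" h "y - 2 * k"] memJ that(1,2) by simp
  qed
  have "sink_orientation k {..<3 * k} ?z N"
    unfolding sink_orientation_def
  proof (intro conjI ballI impI)
    \<comment> \<open>The sink stays a sink because \<open>?z = 4 * h + 1\<close> lies outside
      \<open>?D\<close>.\<close>
    show "N ?z = {}" using Mz k by (auto simp: N_def)
  next
    fix c assume c: "c \<in> {..<3 * k}"
    then show "N c \<subseteq> {..<3 * k} - {c}"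
      using M[of c] J[of c] by (cases "c < 2 * k") (auto simp: N_def)
    show "k dvd card (N c)"
    proof (cases "c < 2 * k")
      case True
      have "finite (M c)" "M c \<inter> ?C = {}"
        using M[OF True] finite_subset[of "M c" "{..<2 * k}"] by auto
      then have "card (M c \<union> ?C) = card (M c) + card ?C"
        by (intro card_Un_disjoint) auto
      then show ?thesis using kM[OF True] True by (simp add: N_def)
    next
      case False
      then have cC: "c \<in> ?C" using c by simp
      have "finite (J c)" "({..<2 * k} - ?D) \<inter> J c = {}"
        using J[OF cC] finite_subset[of "J c" ?C] by auto
      then have "card (N c) = card ({..<2 * k} - ?D) + card (J c)"
        using False by (simp add: N_def card_Un_disjoint)
      also have "card ({..<2 * k} - ?D) = 2 * k - h"
        using k by (subst card_Diff_subset) auto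
      finally have "card (N c) = 2 * k" using cardJ[OF cC] k by simp
      then show ?thesis by simp
    qed
  next
    fix x y assume xy: "x \<in> {..<3 * k}" "y \<in> {..<3 * k}" "x \<noteq> y"
    consider "x < 2 * k" "y < 2 * k" | "x < 2 * k" "y \<in> ?C" | "x \<in> ?C" "y < 2 * k"
      | "x \<in> ?C" "y \<in> ?C"
      using xy by fastforce
    then show "x \<in> N y \<longleftrightarrow> y \<notin> N x"
    proof cases
      case 1
      then show ?thesis using tourM[of x y] xy(3) by (auto simp: N_def)
    next
      case 2
      then show ?thesis using M[of x] J[of y] by (auto simp: N_def)
    next
      case 3
      then show ?thesis using M[of y] J[of x] by (auto simp: N_def)
    next
      case 4
      then show ?thesis using tourJ[of x y] xy(3) by (auto simp: N_def)
    qed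
  next
    fix c assume c: "c \<in> {..<3 * k} - {?z, 0}"
    show "\<exists>d\<in>N c. d < c \<and> d \<noteq> ?z"
    proof (cases "c < 2 * k")
      case True
      then show ?thesis using redM[of c] c by (auto simp: N_def)
    next
      case False
      \<comment> \<open>\<open>?D\<close> starts at \<open>1\<close>, so every new vertex dominates
        \<open>0\<close>.\<close>
      then have "0 \<in> N c" "0 < c" "0 \<noteq> ?z" using k by (auto simp: N_def)
      then show ?thesis by blast
    qed
  qed (use k in auto)
  then show ?thesis by blast
qed

text \<open>The added vertex dominates all others; its out-degree \<open>v\<close> is a multiple of
  \<open>k\<close>, and \<open>0\<close> is its smaller out-neighbour.\<close>

lemma sink_orientation_Suc:
  assumes "sink_orientation k {..<v} z N" "k dvd v"
  shows "sink_orientation k {..<Suc v} z (N(v := {..<v}))"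
proof -
  have z: "z < v" "0 < v" "z \<noteq> 0" "N z = {}"
    and N: "\<And>c. c < v \<Longrightarrow> N c \<subseteq> {..<v} - {c}" and kN: "\<And>c. c < v \<Longrightarrow> k dvd card (N c)"
    and tour: "\<And>x y. x < v \<Longrightarrow> y < v \<Longrightarrow> x \<noteq> y \<Longrightarrow> x \<in> N y \<longleftrightarrow> y \<notin> N x"
    and red: "\<And>c. c < v \<Longrightarrow> c \<noteq> z \<Longrightarrow> c \<noteq> 0 \<Longrightarrow> \<exists>d\<in>N c. d < c \<and> d \<noteq> z"
    using assms(1) unfolding sink_orientation_def Ball_def lessThan_iff by blast+
  show ?thesis
    unfolding sink_orientation_def
  proof (intro conjI ballI impI)
    fix c assume "c \<in> {..<Suc v}"
    then show "(N(v := {..<v})) c \<subseteq> {..<Suc v} - {c}"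
      using N[of c] by (cases "c = v") (auto simp: less_Suc_eq)
  next
    fix c assume "c \<in> {..<Suc v}"
    then show "k dvd card ((N(v := {..<v})) c)"
      using kN[of c] assms(2) by (auto simp: less_Suc_eq)
  next
    fix x y assume "x \<in> {..<Suc v}" "y \<in> {..<Suc v}" "x \<noteq> y"
    then show "x \<in> (N(v := {..<v})) y \<longleftrightarrow> y \<notin> (N(v := {..<v})) x"
      using tour[of x y] N[of x] N[of y] by (auto simp: less_Suc_eq)
  next
    fix c assume c: "c \<in> {..<Suc v} - {z, 0}"
    show "\<exists>d\<in>(N(v := {..<v})) c. d < c \<and> d \<noteq> z"
    proof (cases "c = v")
      case True
      then show ?thesis using z by (intro bexI[of _ 0]) auto
    next
      case False
      then show ?thesis using red[of c] c by (auto simp: less_Suc_eq)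
    qed
  qed (use z in auto)
qed

section \<open>Necessary conditions\<close>

lemma L1_star_graphD:
  assumes "n \<in> L1 (star_graph k) v"
  shows "v - 1 \<le> n" "[n = 0] (mod 4) \<or> [n = 1] (mod 4)"
proof -
  obtain V W :: "nat set" and \<B> \<B>' f where V: "finite V" "card V = v"
    and W: "finite W" "card W = n"
    and B: "is_design (complete_graph V) (star_graph k) \<B>"
    and B': "is_design (complete_graph W) (path_graph 3) \<B>'"
    and f: "down_link f \<B> \<B>'"
    using assms unfolding L1_def by blast
  show "[n = 0] (mod 4) \<or> [n = 1] (mod 4)"
    using even_card_edges_if_path_design[OF simple_graph_complete[OF W(1)] B']
    unfolding even_card_edges_complete_iff[OF W(1)] W(2) .
  \<comment> \<open>The star \<open>b\<close> covering \<open>{x, y}\<close> has its centre in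
    \<open>{x, y}\<close>. The path \<open>f b\<close> has an edge, which contains this centre and
    lies in \<open>W\<close>.\<close>
  have meet: "x \<in> W \<or> y \<in> W" if "x \<in> V" "y \<in> V" "x \<noteq> y" for x y
  proof -
    have "{x, y} \<in> edges (complete_graph V)"
      using that by (simp add: edges_complete_graph)
    then obtain b where b: "b \<in> \<B>" "{x, y} \<in> edges b"
      using B by (auto simp: is_design_def)
    then obtain c where c: "\<And>e. e \<in> edges b \<Longrightarrow> c \<in> e"
      using B graph_iso_star_graphD[of b k] by (auto simp: is_design_def subgraph_def)
    have fb: "f b \<in> \<B>'" "subgraph (f b) b"
      using f b(1) by (auto simp: down_link_def)
    then have "card (edges (f b)) = 2"
      using B' card_edges_path_block[of "f b"] by (auto simp: is_design_def subgraph_def)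
    then obtain e where e: "e \<in> edges (f b)" by (metis card.empty ex_in_conv zero_neq_numeral)
    then have "c \<in> e" using fb(2) c by (auto simp: subgraph_def)
    moreover have "e \<subseteq> W"
      using B' fb(1) e by (auto simp: is_design_def edges_complete_graph)
    ultimately show ?thesis using c[OF b(2)] by auto
  qed
  have "card (V - W) \<le> 1"
    using V(1) meet by (subst One_nat_def, subst card_le_Suc0_iff_eq) auto
  moreover have "card V \<le> card (V - W) + card W"
    using V(1) W(1) by (metis card_Un_le card_mono Un_Diff_cancel2 finite_Un le_trans sup_ge1)
  ultimately show "v - 1 \<le> n" using V W by simp
qed

section \<open>Admissible orders and conclusion\<close>

text \<open>The prime below \<open>k\<close> misses one of the coprime factors, so \<open>k\<close>
  is coprime to that factor and divides the other.\<close>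

lemma primepow_dvd_mult_coprime:
  fixes a b :: nat
  assumes "primepow k" "k dvd a * b" "coprime a b"
  shows "k dvd a \<or> k dvd b"
proof -
  obtain p e where p: "prime p" "k = p ^ e"
    using assms(1) by (auto simp: primepow_def)
  have "\<not> p dvd a \<or> \<not> p dvd b"
    using assms(3) p(1) by (meson coprime_common_divisor not_prime_unit)
  then have "coprime k a \<or> coprime k b"
    using p by (metis coprime_power_left_iff prime_imp_coprime)
  then show ?thesis
    using assms(2) by (metis coprime_dvd_mult_left_iff coprime_dvd_mult_right_iff)
qed

lemma ex_sink_orientation:
  assumes "3 < k" "primepow k" "2 * k \<le> v" "v < 4 * k" "[v * (v - 1) = 0] (mod (2 * k))"
  shows "\<exists>z N. sink_orientation k {..<v} z N"
proof -
  have dvd: "2 * k dvd v * (v - 1)" using assms(5) by (simp add: cong_0_iff)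
  have k0: "0 < k" using assms(1) by simp
  \<comment> \<open>Cancelling \<open>k\<close> from \<open>2 * k dvd v * (v - 1)\<close> leaves
    \<open>3 * (3 * k - 1)\<close> or \<open>3 * (3 * k + 1)\<close> even, which is impossible for
    even \<open>k\<close>.\<close>
  have odd: "odd k" if "v = 3 * k \<or> v = Suc (3 * k)"
  proof
    assume "even k"
    have "v * (v - 1) = k * (3 * (3 * k - 1)) \<or> v * (v - 1) = k * (3 * (3 * k + 1))"
      using that by (auto simp: algebra_simps)
    then have "2 * k dvd k * (3 * (3 * k - 1)) \<or> 2 * k dvd k * (3 * (3 * k + 1))"
      using dvd by auto
    then have "k * 2 dvd k * (3 * (3 * k - 1)) \<or> k * 2 dvd k * (3 * (3 * k + 1))"
      by (simp only: mult.commute)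
    then have "even (3 * (3 * k - 1)) \<or> even (3 * (3 * k + 1))"
      using k0 by (simp only: nat_mult_dvd_cancel1)
    then show False using \<open>even k\<close> k0 by auto
  qed
  have "coprime v (v - 1)" using assms(1,3) coprime_diff_one_right_nat[of v] by simp
  then consider "k dvd v" | "k dvd v - 1"
    using primepow_dvd_mult_coprime[OF assms(2), of v "v - 1"] dvd by (meson dvd_mult_right)
  then have "v = 2 * k \<or> v = 3 * k \<or> v = Suc (2 * k) \<or> v = Suc (3 * k)"
  proof cases
    case 1
    then obtain c where c: "v = k * c" by blast
    then have "2 \<le> c" "c < 4" using assms(3,4) k0 by (simp_all add: mult.commute[of k])
    then have "c = 2 \<or> c = 3" by auto
    then show ?thesis using c by auto
  next
    case 2
    then obtain c where c: "v - 1 = k * c" by blast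
    \<comment> \<open>The quotient \<open>1\<close> is excluded since
      \<open>v - 1 \<ge> 2 * k - 1 > k\<close>.\<close>
    have "k * 1 < k * c" "k * c < k * 4" using assms(1,3,4) c by linarith+
    then have "1 < c" "c < 4" using k0 by simp_all
    then have "c = 2 \<or> c = 3" by auto
    then show ?thesis using c assms(1,3) by auto
  qed
  then consider "v = 2 * k \<or> v = Suc (2 * k)" | "v = 3 * k \<or> v = Suc (3 * k)" by blast
  then show ?thesis
  proof cases
    case 1
    obtain N where N: "sink_orientation k {..<2 * k} (2 * k - 1) N"
      using sink_orientation_2k[of k] assms(1) by simp
    then have "sink_orientation k {..<Suc (2 * k)} (2 * k - 1) (N(2 * k := {..<2 * k}))"
      by (rule sink_orientation_Suc) simp
    with 1 N show ?thesis by metis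
  next
    case 2
    then have "odd k" by (rule odd)
    then obtain h where "k = 2 * h + 1" by (rule oddE)
    then obtain N where N: "sink_orientation k {..<3 * k} (2 * k - 1) N"
      using sink_orientation_3k[of k h] assms(1) by auto
    then have "sink_orientation k {..<Suc (3 * k)} (2 * k - 1) (N(3 * k := {..<3 * k}))"
      by (rule sink_orientation_Suc) simp
    with 2 N show ?thesis by metis
  qed
qed

theorem theorem5p3:
  fixes k v :: nat
  assumes "k > 3" and "primepow k"
    and "2 * k \<le> v" and "v < 4 * k" and "[v * (v - 1) = 0] (mod (2 * k))"
  shows "L1 (star_graph k) v = {n. n \<ge> v - 1 \<and> ([n = 0] (mod 4) \<or> [n = 1] (mod 4))}"
proof -
  obtain z N where "sink_orientation k {..<v} z N"
    using ex_sink_orientation[OF assms] by blast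
  then have "n \<in> L1 (star_graph k) v" if "v - 1 \<le> n" "[n = 0] (mod 4) \<or> [n = 1] (mod 4)" for n
    using L1_if_sink_orientation[of k "{..<v}" z N n] assms(1) that by simp
  then show ?thesis using L1_star_graphD by blast
qed

end
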